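(* Let $N$ be a finite set with $|N|\geq 3$. Every facet-defining inequality for the cone $\mathcal{T}(N)$ of totally balanced games over $N$ that corresponds to a strict subset of $N$, that is, the inequality $m(M)\geq\sum_{S\in\mathcal{B}}\gamma_S\, m(S)$ assigned to an irreducible min-balanced set system $\mathcal{B}$ on some $M\subset N$ with $|M|\geq 2$, is also facet-defining for the cone $\mathcal{E}(N)$ of exact games over $N$. Moreover, the conjugate inequality to each such inequality is facet-defining for $\mathcal{E}(N)$.
   Context: $\mathcal{P}(N)$ is the power set of $N$, $\subset$ is strict inclusion, and $\chi_S$ is the incidence vector of $S$. A non-trivial set system on a finite set $M$, $|M|\geq 2$, is a system $\mathcal{B}$ with $\emptyset\neq\mathcal{B}\subseteq\mathcal{P}(M)\setminus\{\emptyset,M\}$. It is balanced on $M$ if $\chi_M$ is a linear combination of $\{\chi_S:S\in\mathcal{B}\}$ with all coefficients strictly positive. It is min-balanced on $M$ if it is balanced on $M$ and no balanced system $\mathcal{C}\subset\mathcal{B}$ on $M$ exists. For min-balanced $\mathcal{B}$ on $M$ there are unique coefficients $\gamma_S$ with $\sum_{S\in\mathcal{B}}\gamma_S\chi_S=\chi_M$, all strictly positive; the inequality assigned to $\mathcal{B}$ is $m(M)\geq\sum_{S\in\mathcal{B}}\gamma_S m(S)$. A min-balanced system $\mathcal{B}$ on $M$ is reducible if there is $\emptyset\neq E\subset M$ such that $\chi_E$ is a conic combination (coefficients $\geq 0$) of $\{\chi_S:S\in\mathcal{B},\ S\subset E\}$; otherwise it is irreducible. It is known (from earlier work) that the facet-defining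 inequalities for $\mathcal{T}(N)$ are exactly those assigned to irreducible min-balanced systems on subsets $M\subseteq N$, $|M|\geq 2$. Conjugate inequality: an inequality is written as $0\leq\langle\theta,m\rangle=\sum_{S\subseteq N}\theta(S)m(S)$ with $\theta\in\mathbb{R}^{\mathcal{P}(N)}$, where (since $m(\emptyset)=0$) the value $\theta(\emptyset)$ is fixed by the convention $\sum_{S\subseteq N}\theta(S)=0$. The conjugate inequality is $0\leq\langle\theta^{\star},m\rangle$ with $\theta^{\star}(L):=\theta(N\setminus L)$ for $L\subseteq N$. For the inequality assigned to $\mathcal{B}$ on $M\subset N$, one has $\theta(M)=1$, $\theta(S)=-\gamma_S$ for $S\in\mathcal{B}$, $\theta(\emptyset)=\sum_{S\in\mathcal{B}}\gamma_S-1$, and $\theta(L)=0$ otherwise. A game over $N$ is $m\in\mathbb{R}^{\mathcal{P}(N)}$ with $m(\emptyset)=0$. Its core is $C(m)=\{x\in\mathbb{R}^N:\sum_{i\in N}x_i=m(N),\ \sum_{i\in S}x_i\geq m(S)\ \forall S\subseteq N\}$. The game $m$ is totally balanced if for each $\emptyset\neq S\subseteq N$ the restriction of $m$ to $\mathcal{P}(S)$ (a game over $S$) has non-empty core. It is exact if for each $S\subseteq N$ there is $x\in C(m)$ with $\sum_{i\in S}x_i=m(S)$. $\mathcal{T}(N)$ and $\mathcal{E}(N)$ are the polyhedral cones of totally balanced and exact games over $N$. An inequality is facet-defining for such a cone if it is valid on the cone and the set of points of the cone satisfying it with equality is a face of dimension one less than that of the cone. Inequalities are not distinguished from their positive multiples.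 *)

theory Defs
  imports "HOL-Analysis.Analysis"
begin

(* The player set N is the universe of a finite type 'n; the space of set functions on the
   power set of N is the Euclidean space real ^ 'n set. *)

definition incidence :: "'n::finite set \<Rightarrow> real ^ 'n" where
  "incidence S = (\<chi> i. indicator S i)"

definition nontrivial_system :: "'n::finite set \<Rightarrow> 'n set set \<Rightarrow> bool" where
  "nontrivial_system M \<B> \<longleftrightarrow> 2 \<le> card M \<and> \<B> \<noteq> {} \<and> \<B> \<subseteq> Pow M - {{}, M}"

definition balancing_coeffs :: "'n::finite set \<Rightarrow> 'n set set \<Rightarrow> ('n set \<Rightarrow> real) \<Rightarrow> bool" where
  "balancing_coeffs M \<B> \<gamma> \<longleftrightarrow>
     (\<forall>S\<in>\<B>. \<gamma> S > 0) \<and> (\<Sum>S\<in>\<B>. \<gamma> S *\<^sub>R incidence S) = incidence M"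

definition balanced_on :: "'n::finite set \<Rightarrow> 'n set set \<Rightarrow> bool" where
  "balanced_on M \<B> \<longleftrightarrow> nontrivial_system M \<B> \<and> (\<exists>\<gamma>. balancing_coeffs M \<B> \<gamma>)"

definition min_balanced_on :: "'n::finite set \<Rightarrow> 'n set set \<Rightarrow> bool" where
  "min_balanced_on M \<B> \<longleftrightarrow> balanced_on M \<B> \<and> \<not> (\<exists>\<C>. \<C> \<subset> \<B> \<and> balanced_on M \<C>)"

definition reducible_on :: "'n::finite set \<Rightarrow> 'n set set \<Rightarrow> bool" where
  "reducible_on M \<B> \<longleftrightarrow> (\<exists>E. E \<noteq> {} \<and> E \<subset> M \<and>
     (\<exists>c. (\<forall>S\<in>{S\<in>\<B>. S \<subset> E}. c S \<ge> 0) \<and>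
          incidence E = (\<Sum>S\<in>{S\<in>\<B>. S \<subset> E}. c S *\<^sub>R incidence S)))"

definition irreducible_min_balanced_on :: "'n::finite set \<Rightarrow> 'n set set \<Rightarrow> bool" where
  "irreducible_min_balanced_on M \<B> \<longleftrightarrow> min_balanced_on M \<B> \<and> \<not> reducible_on M \<B>"

definition game :: "real ^ ('n::finite set) \<Rightarrow> bool" where
  "game m \<longleftrightarrow> m $ {} = 0"

(* The core, in R^S, of the restriction of m to the power set of S; vectors in R^S are
   extensional functions on S. *)
definition core :: "'n::finite set \<Rightarrow> real ^ 'n set \<Rightarrow> ('n \<Rightarrow> real) set" where
  "core S m = {x \<in> S \<rightarrow>\<^sub>E UNIV. (\<Sum>i\<in>S. x i) = m $ S \<and> (\<forall>T\<subseteq>S. (\<Sum>i\<in>T. x i) \<ge> m $ T)}"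

definition totally_balanced_cone :: "(real ^ ('n::finite set)) set" where
  "totally_balanced_cone = {m. game m \<and> (\<forall>S. S \<noteq> {} \<longrightarrow> core S m \<noteq> {})}"

definition exact_cone :: "(real ^ ('n::finite set)) set" where
  "exact_cone = {m. game m \<and> (\<forall>S. \<exists>x\<in>core UNIV m. (\<Sum>i\<in>S. x i) = m $ S)}"

(* The vector \<theta> stands for the inequality 0 \<le> \<theta> \<bullet> m. *)
definition facet_defining :: "'a::euclidean_space \<Rightarrow> 'a set \<Rightarrow> bool" where
  "facet_defining \<theta> K \<longleftrightarrow> (\<forall>m\<in>K. 0 \<le> \<theta> \<bullet> m) \<and> {m\<in>K. \<theta> \<bullet> m = 0} facet_of K"

(* The value at {} is irrelevant on games; it is chosen so that the entries sum to 0, which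
   fixes the coefficient of N in the conjugate. *)
definition assigned_ineq ::
  "'n::finite set \<Rightarrow> 'n set set \<Rightarrow> ('n set \<Rightarrow> real) \<Rightarrow> real ^ 'n set" where
  "assigned_ineq M \<B> \<gamma> = (\<chi> L.
     if L = M then 1
     else if L \<in> \<B> then - \<gamma> L
     else if L = {} then (\<Sum>S\<in>\<B>. \<gamma> S) - 1
     else 0)"

definition conjugate_ineq :: "real ^ ('n::finite set) \<Rightarrow> real ^ 'n set" where
  "conjugate_ineq \<theta> = (\<chi> L. \<theta> $ (UNIV - L))"

lemma assigned_ineq_inner:
  assumes "nontrivial_system M \<B>" and "game m"
  shows "assigned_ineq M \<B> \<gamma> \<bullet> m = m $ M - (\<Sum>S\<in>\<B>. \<gamma> S * m $ S)"
proof -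
  have M: "M \<notin> \<B>" "{} \<notin> \<B>" "M \<noteq> {}" and m: "m $ {} = 0"
    using assms by (auto simp: nontrivial_system_def game_def)
  have "assigned_ineq M \<B> \<gamma> \<bullet> m =
      (\<Sum>L\<in>UNIV. (if L = M then m $ M else 0) - (if L \<in> \<B> then \<gamma> L * m $ L else 0))"
    unfolding inner_vec_def by (rule sum.cong) (use M m in \<open>auto simp: assigned_ineq_def\<close>)
  also have "\<dots> = m $ M - (\<Sum>S\<in>\<B>. \<gamma> S * m $ S)"
    by (simp add: sum_subtractf sum.If_cases)
  finally show ?thesis .
qed

lemma assigned_ineq_sum:
  assumes "nontrivial_system M \<B>"
  shows "(\<Sum>L\<in>UNIV. assigned_ineq M \<B> \<gamma> $ L) = 0"
proof -
  have M: "M \<notin> \<B>" "{} \<notin> \<B>" "M \<noteq> {}"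
    using assms by (auto simp: nontrivial_system_def)
  have "(\<Sum>L\<in>UNIV. assigned_ineq M \<B> \<gamma> $ L) =
      (\<Sum>L\<in>UNIV. (if L = M then 1 else 0) - (if L \<in> \<B> then \<gamma> L else 0)
        + (if L = {} then (\<Sum>S\<in>\<B>. \<gamma> S) - 1 else 0))"
    by (rule sum.cong) (use M in \<open>auto simp: assigned_ineq_def\<close>)
  also have "\<dots> = 0"
    by (simp add: sum_subtractf sum.distrib sum.If_cases)
  finally show ?thesis .
qed

end

theory Submission
  imports Defs
begin

text \<open>It suffices to find an exact game \<open>m\<close> on the hyperplane \<open>\<theta> \<bullet> m = 0\<close> that stays exact under every
  small perturbation along this hyperplane: exact games are totally balanced, so \<open>m\<close> serves both
  cones, and \<open>m \<mapsto> (S \<mapsto> m(N - S) - m(N))\<close> is a linear involution of the exact cone that exchanges an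
  inequality with its conjugate.

  The game \<open>m\<close> vanishes on \<open>M\<close>, \<open>N\<close> and the members of \<open>\<B>\<close>, so that \<open>0\<close> is a core element tight exactly
  on these sets. By irreducibility and Farkas' lemma, every other \<open>T\<close> admits a vector \<open>y\<close> with
  \<open>y(N) = 0\<close>, \<open>y(T) < 0\<close> and \<open>y > 0\<close> on \<open>\<B>\<close>; the minimum of these vectors, perturbed by a strictly
  convex game, defines \<open>m\<close> on the remaining sets, and every set other than \<open>M\<close> and \<open>N\<close> gets a core
  element that is tight on no other set. A perturbation is met at \<open>M\<close> because the incidence vectors of
  \<open>\<B>\<close> and \<open>N\<close> are linearly independent when \<open>M\<close> is a strict subset of \<open>N\<close>.\<close>

section \<open>Faces of codimension one\<close>

lemma facet_of_linear_image:
  fixes f :: "'a::euclidean_space \<Rightarrow> 'b::euclidean_space"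
  assumes "linear f" "inj f"
  shows "f ` F facet_of f ` K \<longleftrightarrow> F facet_of K"
  using assms by (simp add: facet_of_def face_of_linear_image)

text \<open>The perturbations at \<open>p\<close> show that the face has at least the dimension of
  \<open>V\<close>, the part of \<open>W\<close> on the hyperplane, which is at most one below that
  of \<open>W\<close>. As \<open>w\<close> lies off the hyperplane, the face is proper, so its
  dimension is exactly one below that of \<open>K\<close>.\<close>

lemma facet_defining_criterion:
  fixes \<theta> :: "'a::euclidean_space"
  assumes K: "convex K" "subspace W" "K \<subseteq> W"
    and valid: "\<And>m. m \<in> K \<Longrightarrow> 0 \<le> \<theta> \<bullet> m"
    and w: "w \<in> K" "\<theta> \<bullet> w \<noteq> 0"
    and p: "p \<in> K" "\<theta> \<bullet> p = 0"
    and perturb: "\<And>d. d \<in> W \<Longrightarrow> \<theta> \<bullet> d = 0 \<Longrightarrow> \<exists>\<epsilon>>0. p + \<epsilon> *\<^sub>R d \<in> K"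
  shows "facet_defining \<theta> K"
proof -
  define F where "F = {m \<in> K. \<theta> \<bullet> m = 0}"
  define V where "V = {d \<in> W. \<theta> \<bullet> d = 0}"
  have face: "F face_of K"
    using face_of_Int_supporting_hyperplane_ge[of K 0 \<theta>] K(1) valid
    by (simp add: F_def Int_def)
  have pF: "p \<in> F" using p by (simp add: F_def)
  have "w \<in> W" using w K by auto
  have "F \<noteq> K" using w by (auto simp: F_def)
  then have lt: "aff_dim F < aff_dim K"
    using face face_of_aff_dim_lt K(1) by blast
  have "V \<subseteq> span ((+) (- p) ` F)"
  proof
    fix d assume "d \<in> V"
    then obtain \<epsilon> where e: "\<epsilon> > 0" "p + \<epsilon> *\<^sub>R d \<in> K"
      using perturb by (auto simp: V_def)
    then have "p + \<epsilon> *\<^sub>R d \<in> F"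
      using \<open>d \<in> V\<close> p by (simp add: F_def V_def inner_add_right)
    then have "\<epsilon> *\<^sub>R d \<in> span ((+) (- p) ` F)"
      by (intro span_base image_eqI[where x = "p + \<epsilon> *\<^sub>R d"]) auto
    then have "(1 / \<epsilon>) *\<^sub>R (\<epsilon> *\<^sub>R d) \<in> span ((+) (- p) ` F)"
      by (rule span_scale)
    then show "d \<in> span ((+) (- p) ` F)" using e by simp
  qed
  then have "dim V \<le> dim ((+) (- p) ` F)" by (rule dim_mono)
  also have "int (dim ((+) (- p) ` F)) = aff_dim F"
    using pF by (metis aff_dim_eq_dim hull_inc)
  finally have VF: "int (dim V) \<le> aff_dim F" by simp
  \<comment> \<open>Subtracting a suitable multiple of \<open>w\<close> moves any vector of
    \<open>W\<close> into the hyperplane.\<close>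
  have "W \<subseteq> span (insert w V)"
  proof
    fix d assume d: "d \<in> W"
    define k where "k = \<theta> \<bullet> d / (\<theta> \<bullet> w)"
    have "d - k *\<^sub>R w \<in> V"
      using d \<open>w \<in> W\<close> K(2) w
      by (simp add: V_def k_def subspace_diff subspace_scale inner_diff_right)
    then show "d \<in> span (insert w V)"
      by (auto simp: span_insert intro: span_base)
  qed
  then have "dim W \<le> dim (insert w V)" by (rule dim_mono)
  also have "\<dots> \<le> dim V + 1" by (simp add: dim_insert)
  finally have "dim W \<le> dim V + 1" .
  moreover have "aff_dim K \<le> int (dim W)"
    using aff_dim_subset[OF K(3)] aff_dim_subspace[OF K(2)] by simp
  ultimately have "aff_dim F = aff_dim K - 1" using VF lt by linarith
  then show ?thesis
    using face pF valid by (auto simp: facet_defining_def facet_of_def F_def)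
qed

section \<open>Totally balanced and exact games\<close>

lemma inner_incidence: "x \<bullet> incidence S = (\<Sum>i\<in>S. x $ i)"
  by (simp add: incidence_def inner_vec_def indicator_def sum.If_cases mult.commute
      if_distrib cong: if_cong)

lemma incidence_empty [simp]: "incidence {} = 0"
  by (simp add: incidence_def vec_eq_iff)

lemma inj_incidence: "inj incidence"
  by (auto simp: inj_def incidence_def vec_eq_iff indicator_def split: if_splits)

text \<open>Replaces extensional functions on \<open>S\<close> by vectors of the whole space. The
  predicate \<open>P\<close> on the additive set function of \<open>x\<close> lets one statement
  serve both cones: a trivial \<open>P\<close> for total balancedness, tightness at a given set for
  exactness.\<close>

lemma core_nonempty_iff:
  "(\<exists>x\<in>core S m. P (\<lambda>T. \<Sum>i\<in>T \<inter> S. x i)) \<longleftrightarrow>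
   (\<exists>x. x \<bullet> incidence S = m $ S \<and> (\<forall>T\<subseteq>S. m $ T \<le> x \<bullet> incidence T)
      \<and> P (\<lambda>T. x \<bullet> incidence (T \<inter> S)))"
  (is "?L \<longleftrightarrow> ?R")
proof
  assume ?L
  then obtain x where x: "x \<in> core S m" "P (\<lambda>T. \<Sum>i\<in>T \<inter> S. x i)" by blast
  then show ?R
    by (intro exI[of _ "\<chi> i. x i"]) (auto simp: core_def inner_incidence)
next
  assume ?R
  then obtain x where x: "x \<bullet> incidence S = m $ S" "\<forall>T\<subseteq>S. m $ T \<le> x \<bullet> incidence T"
    "P (\<lambda>T. x \<bullet> incidence (T \<inter> S))" by blast
  have [simp]: "(\<Sum>i\<in>T. if i \<in> S then x $ i else undefined) = x \<bullet> incidence T"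
    if "T \<subseteq> S" for T
    unfolding inner_incidence by (rule sum.cong) (use that in auto)
  have "(\<lambda>i\<in>S. x $ i) \<in> core S m" "P (\<lambda>T. \<Sum>i\<in>T \<inter> S. (\<lambda>i\<in>S. x $ i) i)"
    using x by (simp_all add: core_def restrict_def PiE_def extensional_def inner_incidence)
  then show ?L by blast
qed

lemma totally_balanced_cone_iff:
  "m \<in> totally_balanced_cone \<longleftrightarrow> m $ {} = 0 \<and>
     (\<forall>S. S \<noteq> {} \<longrightarrow> (\<exists>x. x \<bullet> incidence S = m $ S \<and> (\<forall>T\<subseteq>S. m $ T \<le> x \<bullet> incidence T)))"
  using core_nonempty_iff[where P = "\<lambda>_. True" and m = m]
  by (simp add: totally_balanced_cone_def game_def flip: ex_in_conv)

lemma exact_cone_iff: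
  "m \<in> exact_cone \<longleftrightarrow> m $ {} = 0 \<and>
     (\<forall>S. \<exists>x. x \<bullet> incidence UNIV = m $ UNIV \<and> (\<forall>T. m $ T \<le> x \<bullet> incidence T)
        \<and> x \<bullet> incidence S = m $ S)"
  using core_nonempty_iff[where P = "\<lambda>f. f _ = m $ _" and m = m and S = UNIV]
  by (simp add: exact_cone_def game_def)

lemma exact_subset_totally_balanced: "exact_cone \<subseteq> totally_balanced_cone"
  unfolding exact_cone_iff totally_balanced_cone_iff subset_iff by blast

lemma convex_totally_balanced_cone:
  "convex (totally_balanced_cone :: (real ^ 'n::finite set) set)"
  unfolding convex_def
proof (intro ballI allI impI)
  fix m m' :: "real ^ 'n set" and u v :: real
  assume a: "m \<in> totally_balanced_cone" "m' \<in> totally_balanced_cone" "0 \<le> u" "0 \<le> v"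
  show "u *\<^sub>R m + v *\<^sub>R m' \<in> totally_balanced_cone"
    unfolding totally_balanced_cone_iff
  proof (intro conjI allI impI)
    show "(u *\<^sub>R m + v *\<^sub>R m') $ {} = 0" using a by (simp add: totally_balanced_cone_iff)
    fix S :: "'n set" assume "S \<noteq> {}"
    then obtain x x' where
      "x \<bullet> incidence S = m $ S \<and> (\<forall>T\<subseteq>S. m $ T \<le> x \<bullet> incidence T)"
      "x' \<bullet> incidence S = m' $ S \<and> (\<forall>T\<subseteq>S. m' $ T \<le> x' \<bullet> incidence T)"
      using a unfolding totally_balanced_cone_iff by meson
    then show "\<exists>x. x \<bullet> incidence S = (u *\<^sub>R m + v *\<^sub>R m') $ S \<and>
        (\<forall>T\<subseteq>S. (u *\<^sub>R m + v *\<^sub>R m') $ T \<le> x \<bullet> incidence T)"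
      using a by (intro exI[of _ "u *\<^sub>R x + v *\<^sub>R x'"])
        (auto simp: inner_add_left intro!: add_mono mult_left_mono)
  qed
qed

lemma convex_exact_cone: "convex (exact_cone :: (real ^ 'n::finite set) set)"
  unfolding convex_def
proof (intro ballI allI impI)
  fix m m' :: "real ^ 'n set" and u v :: real
  assume a: "m \<in> exact_cone" "m' \<in> exact_cone" "0 \<le> u" "0 \<le> v"
  show "u *\<^sub>R m + v *\<^sub>R m' \<in> exact_cone"
    unfolding exact_cone_iff
  proof (intro conjI allI)
    show "(u *\<^sub>R m + v *\<^sub>R m') $ {} = 0" using a by (simp add: exact_cone_iff)
    fix S :: "'n set"
    obtain x x' where
      "x \<bullet> incidence UNIV = m $ UNIV \<and> (\<forall>T. m $ T \<le> x \<bullet> incidence T) \<and> x \<bullet> incidence S = m $ S"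
      "x' \<bullet> incidence UNIV = m' $ UNIV \<and> (\<forall>T. m' $ T \<le> x' \<bullet> incidence T)
        \<and> x' \<bullet> incidence S = m' $ S"
      using a unfolding exact_cone_iff by meson
    then show "\<exists>x. x \<bullet> incidence UNIV = (u *\<^sub>R m + v *\<^sub>R m') $ UNIV \<and>
        (\<forall>T. (u *\<^sub>R m + v *\<^sub>R m') $ T \<le> x \<bullet> incidence T) \<and>
        x \<bullet> incidence S = (u *\<^sub>R m + v *\<^sub>R m') $ S"
      using a by (intro exI[of _ "u *\<^sub>R x + v *\<^sub>R x'"])
        (auto simp: inner_add_left intro!: add_mono mult_left_mono)
  qed
qed

text \<open>Here \<open>x\<close> is a core element of \<open>m\<close> tight at \<open>S\<close>,
  and \<open>p\<close> corrects it to first order. Where \<open>x\<close> is slack, it stays slack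
  for small \<open>\<epsilon>\<close>; where it is tight, \<open>p\<close> agrees with
  \<open>d\<close>. There are finitely many sets, so one \<open>\<epsilon>\<close> serves
  all.\<close>

lemma exact_perturbation:
  fixes m d :: "real ^ 'n::finite set"
  assumes m: "m $ {} = 0" and d: "d $ {} = 0"
    and tight: "\<And>S. \<exists>x p. x \<bullet> incidence UNIV = m $ UNIV \<and> p \<bullet> incidence UNIV = d $ UNIV \<and>
        x \<bullet> incidence S = m $ S \<and> p \<bullet> incidence S = d $ S \<and>
        (\<forall>T. m $ T < x \<bullet> incidence T \<or> m $ T = x \<bullet> incidence T \<and> d $ T = p \<bullet> incidence T)"
  shows "\<exists>\<epsilon>>0. m + \<epsilon> *\<^sub>R d \<in> exact_cone"
proof -
  obtain x p where xp: "\<And>S. x S \<bullet> incidence UNIV = m $ UNIV"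
      "\<And>S. p S \<bullet> incidence UNIV = d $ UNIV"
      "\<And>S. x S \<bullet> incidence S = m $ S" "\<And>S. p S \<bullet> incidence S = d $ S"
      "\<And>S T. m $ T < x S \<bullet> incidence T \<or> m $ T = x S \<bullet> incidence T \<and> d $ T = p S \<bullet> incidence T"
    using tight by metis
  have "\<forall>\<^sub>F \<epsilon> in at_right 0. (m + \<epsilon> *\<^sub>R d) $ T \<le> (x S + \<epsilon> *\<^sub>R p S) \<bullet> incidence T" for S T
  proof (cases "m $ T < x S \<bullet> incidence T")
    case True
    have "((\<lambda>\<epsilon>. (x S + \<epsilon> *\<^sub>R p S) \<bullet> incidence T - (m + \<epsilon> *\<^sub>R d) $ T)
        \<longlongrightarrow> (x S + 0 *\<^sub>R p S) \<bullet> incidence T - (m + 0 *\<^sub>R d) $ T) (at_right 0)"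
      by (intro tendsto_intros)
    then have "\<forall>\<^sub>F \<epsilon> in at_right 0. 0 < (x S + \<epsilon> *\<^sub>R p S) \<bullet> incidence T - (m + \<epsilon> *\<^sub>R d) $ T"
      using True by (intro order_tendstoD) auto
    then show ?thesis by (rule eventually_mono) simp
  next
    case False
    then show ?thesis using xp(5)[of T S] by (simp add: inner_add_left)
  qed
  then have "\<forall>\<^sub>F \<epsilon> in at_right 0. \<forall>S T. (m + \<epsilon> *\<^sub>R d) $ T \<le> (x S + \<epsilon> *\<^sub>R p S) \<bullet> incidence T"
    by (intro eventually_all_finite)
  moreover have "\<forall>\<^sub>F \<epsilon> in at_right (0::real). 0 < \<epsilon>"
    by (simp add: eventually_at_right_less)
  ultimately have "\<forall>\<^sub>F \<epsilon> in at_right 0. 0 < \<epsilon> \<and>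
      (\<forall>S T. (m + \<epsilon> *\<^sub>R d) $ T \<le> (x S + \<epsilon> *\<^sub>R p S) \<bullet> incidence T)"
    by eventually_elim simp
  then obtain \<epsilon> where e: "0 < \<epsilon>"
      "\<And>S T. (m + \<epsilon> *\<^sub>R d) $ T \<le> (x S + \<epsilon> *\<^sub>R p S) \<bullet> incidence T"
    using eventually_happens' trivial_limit_at_right_real by blast
  have "m + \<epsilon> *\<^sub>R d \<in> exact_cone"
    unfolding exact_cone_iff
  proof (intro conjI allI)
    fix S
    show "\<exists>y. y \<bullet> incidence UNIV = (m + \<epsilon> *\<^sub>R d) $ UNIV \<and>
        (\<forall>T. (m + \<epsilon> *\<^sub>R d) $ T \<le> y \<bullet> incidence T) \<and> y \<bullet> incidence S = (m + \<epsilon> *\<^sub>R d) $ S"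
      using e(2) xp by (intro exI[of _ "x S + \<epsilon> *\<^sub>R p S"]) (simp add: inner_add_left)
  qed (use m d in simp)
  then show ?thesis using e by blast
qed

section \<open>The conjugation involution\<close>

text \<open>The summand \<open>m $ {}\<close> is zero on games; it makes the map an involution of the whole space.\<close>

definition antidual :: "real ^ 'n::finite set \<Rightarrow> real ^ 'n set" where
  "antidual m = (\<chi> S. m $ (UNIV - S) - m $ UNIV + m $ {})"

lemma linear_antidual: "linear antidual"
  by (rule linearI) (simp_all add: antidual_def vec_eq_iff algebra_simps)

lemma antidual_antidual [simp]: "antidual (antidual m) = m"
  by (simp add: antidual_def vec_eq_iff double_diff)

lemma inj_antidual: "inj antidual"
  by (metis antidual_antidual injI)

text \<open>If \<open>x\<close> is a core element of \<open>m\<close> tight at the complement of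
  \<open>S\<close>, then \<open>- x\<close> is a core element of \<open>antidual m\<close> tight at
  \<open>S\<close>: the total is fixed, so a lower bound on a set becomes a lower bound for
  \<open>- x\<close> on its complement.\<close>

lemma antidual_exact:
  fixes m :: "real ^ 'n::finite set"
  assumes "m \<in> exact_cone"
  shows "antidual m \<in> exact_cone"
proof -
  have m: "m $ {} = 0" using assms by (simp add: exact_cone_iff)
  have compl: "incidence (UNIV - T) = incidence UNIV - incidence T" for T :: "'n set"
    by (simp add: incidence_def vec_eq_iff indicator_def)
  show ?thesis
    unfolding exact_cone_iff
  proof (intro conjI allI)
    show "antidual m $ {} = 0" by (simp add: antidual_def m)
    fix S :: "'n set"
    obtain x where x: "x \<bullet> incidence UNIV = m $ UNIV" "\<And>T. m $ T \<le> x \<bullet> incidence T"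
        "x \<bullet> incidence (UNIV - S) = m $ (UNIV - S)"
      using assms unfolding exact_cone_iff by meson
    show "\<exists>y. y \<bullet> incidence UNIV = antidual m $ UNIV \<and>
        (\<forall>T. antidual m $ T \<le> y \<bullet> incidence T) \<and> y \<bullet> incidence S = antidual m $ S"
      using x(1,3) x(2)[of "UNIV - _"]
      by (intro exI[of _ "- x"]) (auto simp: antidual_def m compl inner_diff_right algebra_simps)
  qed
qed

text \<open>Since the entries of \<open>\<theta>\<close> sum to 0, the constant summand
  \<open>m $ {} - m $ UNIV\<close> of \<open>antidual\<close> cancels; what remains is reindexing by
  complements.\<close>

lemma inner_conjugate_ineq:
  fixes \<theta> :: "real ^ 'n::finite set"
  assumes "(\<Sum>L\<in>UNIV. \<theta> $ L) = 0"
  shows "conjugate_ineq \<theta> \<bullet> m = \<theta> \<bullet> antidual m"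
proof -
  have "conjugate_ineq \<theta> \<bullet> m = (\<Sum>L\<in>UNIV. \<theta> $ (UNIV - L) * m $ L)"
    by (simp add: inner_vec_def conjugate_ineq_def)
  also have "\<dots> = (\<Sum>L\<in>UNIV. \<theta> $ L * m $ (UNIV - L))"
    by (rule sum.reindex_bij_witness[of _ "\<lambda>L. UNIV - L" "\<lambda>L. UNIV - L"]) (auto simp: double_diff)
  also have "\<dots> = (\<Sum>L\<in>UNIV. \<theta> $ L * m $ (UNIV - L)) + (\<Sum>L\<in>UNIV. \<theta> $ L) * (m $ {} - m $ UNIV)"
    using assms by simp
  also have "\<dots> = (\<Sum>L\<in>UNIV. \<theta> $ L * (m $ (UNIV - L) - m $ UNIV + m $ {}))"
    by (simp add: sum_distrib_right flip: sum.distrib) (simp add: algebra_simps)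
  also have "\<dots> = \<theta> \<bullet> antidual m"
    by (simp add: inner_vec_def antidual_def)
  finally show ?thesis .
qed

lemma facet_defining_conjugate:
  fixes \<theta> :: "real ^ 'n::finite set"
  assumes sum: "(\<Sum>L\<in>UNIV. \<theta> $ L) = 0" and facet: "facet_defining \<theta> exact_cone"
  shows "facet_defining (conjugate_ineq \<theta>) exact_cone"
proof -
  \<comment> \<open>As \<open>antidual\<close> is an involution preserving the exact cone, images
    under it are preimages.\<close>
  have img: "antidual ` {m \<in> exact_cone. P m} = {m \<in> exact_cone. P (antidual m)}"
    for P :: "real ^ 'n set \<Rightarrow> bool"
  proof (intro set_eqI iffI)
    fix m assume "m \<in> {m \<in> exact_cone. P (antidual m)}"
    then show "m \<in> antidual ` {m \<in> exact_cone. P m}"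
      by (intro image_eqI[where x = "antidual m"]) (auto simp: antidual_exact)
  qed (auto simp: antidual_exact)
  have "antidual ` {m \<in> exact_cone. \<theta> \<bullet> m = 0} facet_of antidual ` exact_cone"
    using facet by (simp add: facet_of_linear_image linear_antidual inj_antidual facet_defining_def)
  then have "{m \<in> exact_cone. \<theta> \<bullet> antidual m = 0} facet_of exact_cone"
    using img[of "\<lambda>m. \<theta> \<bullet> m = 0"] img[of "\<lambda>_. True"] by simp
  then show ?thesis
    using facet antidual_exact by (auto simp: facet_defining_def inner_conjugate_ineq[OF sum])
qed

section \<open>A strictly convex game\<close>

text \<open>With \<open>n\<close> players and \<open>t\<close> the cardinality this is
  \<open>t^2 - n * t\<close>, strictly convex in \<open>t\<close> and normalized to vanish at the
  full set. It serves as the point off the hyperplane and as the term that makes weak inequalities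
  strict.\<close>

definition quad_game :: "real ^ 'n::finite set" where
  "quad_game = (\<chi> T. - real (card T) * (real CARD('n) - real (card T)))"

text \<open>A core element of \<^const>\<open>quad_game\<close> that is tight only at \<open>{}\<close>, \<open>U\<close> and the full set.\<close>

definition tilt :: "'n::finite set \<Rightarrow> real ^ 'n" where
  "tilt U = (\<chi> i. if i \<in> U then real (card U) - real CARD('n) else real (card U))"

lemma tilt_incidence:
  fixes T U :: "'n::finite set"
  shows "tilt U \<bullet> incidence T =
    real (card (T - U)) * real (card U) - real (card (T \<inter> U)) * (real CARD('n) - real (card U))"
proof -
  have "tilt U \<bullet> incidence T = (\<Sum>i\<in>T. if i \<in> U then real (card U) - real CARD('n) else real (card U))"
    by (simp add: inner_incidence tilt_def)
  also have "\<dots> = (\<Sum>i\<in>T \<inter> U. real (card U) - real CARD('n)) + (\<Sum>i\<in>T - U. real (card U))"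
    by (simp add: sum.If_cases Diff_eq)
  finally show ?thesis by (simp add: algebra_simps)
qed

lemma tilt_UNIV: "tilt U \<bullet> incidence UNIV = 0"
  by (simp add: tilt_incidence card_Diff_subset of_nat_diff card_mono algebra_simps)

lemma tilt_self: "tilt U \<bullet> incidence U = quad_game $ U"
  by (simp add: tilt_incidence quad_game_def)

text \<open>In the notation \<open>a\<close>, \<open>b\<close>, \<open>u\<close>, \<open>n\<close>
  below, the difference of the two sides is
  \<open>a * (u - a) + b * (n - u - b) + 2 * b * (u - a)\<close>, a sum of nonnegative terms. They
  all vanish only if \<open>T\<close> is empty, equal to \<open>U\<close>, or full.\<close>

lemma tilt_greater_quad:
  fixes T U :: "'n::finite set"
  assumes T: "T \<noteq> {}" "T \<noteq> UNIV" "T \<noteq> U"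
  shows "quad_game $ T < tilt U \<bullet> incidence T"
proof -
  define a b u n where "a = real (card (T \<inter> U))" "b = real (card (T - U))"
    "u = real (card U)" "n = real CARD('n)"
  note defs = this
  have cT: "real (card T) = a + b"
    unfolding defs by (metis card_Int_Diff finite of_nat_add)
  have au: "a \<le> u" unfolding defs by (simp add: card_mono)
  have "card (T - U) + card U = card (T \<union> U)"
    by (metis Un_Diff_cancel2 card_Un_disjoint Diff_disjoint finite inf_commute)
  then have bu: "b + u = real (card (T \<union> U))" unfolding defs by linarith
  have bun: "b + u \<le> n" unfolding bu by (simp add: defs card_mono)
  have nonneg: "0 \<le> a" "0 \<le> b" by (simp_all add: defs)
  have "0 < a * (u - a) + b * ((n - u - b) + 2 * (u - a))"
  proof (cases "a < u")
    case True
    show ?thesis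
    proof (cases "a = 0")
      case True
      then have "0 < b" using cT T by (metis add_0 card_gt_0_iff finite of_nat_0_less_iff)
      then show ?thesis using \<open>a < u\<close> bun nonneg by (simp add: True)
    next
      case False
      then have "0 < a * (u - a)" using \<open>a < u\<close> nonneg by simp
      moreover have "0 \<le> b * ((n - u - b) + 2 * (u - a))"
        using \<open>a < u\<close> bun nonneg by simp
      ultimately show ?thesis by linarith
    qed
  next
    case False
    then have "a = u" using au by simp
    then have "card (T \<inter> U) = card U" by (simp add: defs)
    then have "U \<subseteq> T" by (metis card_subset_eq finite inf_le2 inf.absorb_iff2 inf_commute)
    then have "T - U \<noteq> {}" "T \<union> U \<noteq> UNIV" using T by auto
    then have "0 < b" "b + u < n"
      unfolding bu by (auto simp: defs card_gt_0_iff intro: psubset_card_mono)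
    then show ?thesis using \<open>a = u\<close> by simp
  qed
  also have "\<dots> = (b * u - a * (n - u)) + (a + b) * (n - (a + b))"
    by (simp add: algebra_simps)
  also have "b * u - a * (n - u) = tilt U \<bullet> incidence T"
    by (simp add: tilt_incidence defs)
  also have "(a + b) * (n - (a + b)) = - quad_game $ T"
    unfolding quad_game_def vec_lambda_beta cT by (simp only: defs minus_mult_left minus_minus)
  finally show ?thesis by simp
qed

lemma quad_game_trivial [simp]: "quad_game $ {} = 0" "quad_game $ UNIV = 0"
  by (simp_all add: quad_game_def)

lemma quad_game_neg:
  fixes T :: "'n::finite set"
  assumes "T \<noteq> {}" "T \<noteq> UNIV"
  shows "quad_game $ T < 0"
proof -
  have "0 < card T" "card T < CARD('n)"
    using assms by (auto simp: card_gt_0_iff intro: psubset_card_mono)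
  then show ?thesis by (simp add: quad_game_def)
qed

lemma quad_game_exact: "quad_game \<in> exact_cone"
  unfolding exact_cone_iff
proof (intro conjI allI)
  fix S
  have "quad_game $ T \<le> tilt S \<bullet> incidence T" for T
    using tilt_greater_quad[of T S] tilt_self[of S] tilt_UNIV[of S]
    by (cases "T = {} \<or> T = UNIV \<or> T = S") auto
  then show "\<exists>x. x \<bullet> incidence UNIV = quad_game $ UNIV \<and>
      (\<forall>T. quad_game $ T \<le> x \<bullet> incidence T) \<and> x \<bullet> incidence S = quad_game $ S"
    by (intro exI[of _ "tilt S"]) (simp add: tilt_UNIV tilt_self)
qed simp

section \<open>Min-balanced systems\<close>

lemma balancing_inner:
  assumes "balancing_coeffs M \<B> \<gamma>"
  shows "x \<bullet> incidence M = (\<Sum>S\<in>\<B>. \<gamma> S * (x \<bullet> incidence S))"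
proof -
  have "x \<bullet> incidence M = x \<bullet> (\<Sum>S\<in>\<B>. \<gamma> S *\<^sub>R incidence S)"
    using assms by (simp add: balancing_coeffs_def)
  then show ?thesis by (simp add: inner_sum_right)
qed

text \<open>A one-sided form of linear independence: applied to \<open>c\<close> and to its negative
  it gives \<open>c S = 0\<close>.\<close>

lemma min_balanced_relation_nonpos:
  assumes mb: "min_balanced_on M \<B>" and bal: "balancing_coeffs M \<B> \<gamma>"
    and rel: "(\<Sum>S\<in>\<B>. c S *\<^sub>R incidence S) = 0" and S: "S \<in> \<B>"
  shows "c S \<le> 0"
proof (rule ccontr)
  assume "\<not> c S \<le> 0"
  \<comment> \<open>Subtracting the largest multiple of \<open>c\<close> that keeps \<open>\<gamma>\<close> nonnegative removes a member of \<open>\<B>\<close>.\<close>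
  define P where "P = {S \<in> \<B>. c S > 0}"
  have P: "finite P" "P \<noteq> {}" using S \<open>\<not> c S \<le> 0\<close> by (auto simp: P_def)
  define t where "t = Min ((\<lambda>S. \<gamma> S / c S) ` P)"
  have "t \<in> (\<lambda>S. \<gamma> S / c S) ` P" unfolding t_def using P by (intro Min_in) auto
  then obtain R where R: "R \<in> P" "t = \<gamma> R / c R" by auto
  define \<delta> where "\<delta> S = \<gamma> S - t * c S" for S
  define \<C> where "\<C> = {S \<in> \<B>. \<delta> S > 0}"
  have \<gamma>pos: "\<gamma> S > 0" if "S \<in> \<B>" for S using bal that by (simp add: balancing_coeffs_def)
  have "t > 0" using R \<gamma>pos by (auto simp: P_def)
  have nonneg: "\<delta> S \<ge> 0" if "S \<in> \<B>" for S
  proof (cases "S \<in> P")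
    case True
    then have "t \<le> \<gamma> S / c S" unfolding t_def using P by (intro Min_le) auto
    then show ?thesis using True by (simp add: \<delta>_def P_def pos_le_divide_eq)
  next
    case False
    then have "t * c S \<le> 0" using that \<open>t > 0\<close> by (simp add: P_def mult_nonneg_nonpos)
    then show ?thesis using \<gamma>pos[OF that] by (simp add: \<delta>_def)
  qed
  have "\<delta> R = 0" using R by (simp add: \<delta>_def P_def)
  then have "R \<in> \<B>" "R \<notin> \<C>" using R by (auto simp: \<C>_def P_def)
  then have sub: "\<C> \<subset> \<B>" by (auto simp: \<C>_def)
  have "(\<Sum>S\<in>\<C>. \<delta> S *\<^sub>R incidence S) = (\<Sum>S\<in>\<B>. \<delta> S *\<^sub>R incidence S)"
    using nonneg by (intro sum.mono_neutral_left) (auto simp: \<C>_def less_le)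
  also have "\<dots> = (\<Sum>S\<in>\<B>. \<gamma> S *\<^sub>R incidence S) - t *\<^sub>R (\<Sum>S\<in>\<B>. c S *\<^sub>R incidence S)"
    by (simp add: \<delta>_def algebra_simps sum_subtractf scaleR_sum_right)
  also have "\<dots> = incidence M" using bal rel by (simp add: balancing_coeffs_def)
  finally have bal': "balancing_coeffs M \<C> \<delta>" by (simp add: balancing_coeffs_def \<C>_def)
  have nt: "nontrivial_system M \<B>" using mb by (simp add: min_balanced_on_def balanced_on_def)
  have "M \<noteq> {}" using nt by (auto simp: nontrivial_system_def)
  then have "incidence M \<noteq> 0" using inj_incidence by (metis incidence_empty injD)
  then have "\<C> \<noteq> {}" using bal' by (auto simp: balancing_coeffs_def)
  then have "balanced_on M \<C>"
    using nt bal' sub by (auto simp: balanced_on_def nontrivial_system_def)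
  then show False using mb sub by (auto simp: min_balanced_on_def)
qed

text \<open>Minimality makes the incidence vectors of \<open>\<B>\<close> linearly independent, so
  arbitrary values on them extend to a linear functional; \<open>p\<close> is the vector
  representing it.\<close>

lemma min_balanced_interpolation:
  fixes M :: "'n::finite set"
  assumes mb: "min_balanced_on M \<B>" and bal: "balancing_coeffs M \<B> \<gamma>"
  obtains p where "\<And>S. S \<in> \<B> \<Longrightarrow> p \<bullet> incidence S = f S"
proof -
  have inj: "inj_on incidence \<B>" using inj_incidence inj_on_subset by blast
  have "independent (incidence ` \<B>)"
  proof (rule independent_if_scalars_zero)
    fix c v assume c: "(\<Sum>v\<in>incidence ` \<B>. c v *\<^sub>R v) = 0" and "v \<in> incidence ` \<B>"
    then obtain S where S: "S \<in> \<B>" "v = incidence S" by auto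
    have rel: "(\<Sum>S\<in>\<B>. c (incidence S) *\<^sub>R incidence S) = 0"
      using c by (simp add: sum.reindex[OF inj])
    then have "(\<Sum>S\<in>\<B>. (- c (incidence S)) *\<^sub>R incidence S) = 0"
      by (simp add: sum_negf)
    then have "- c (incidence S) \<le> 0"
      by (rule min_balanced_relation_nonpos[OF mb bal _ S(1)])
    moreover have "c (incidence S) \<le> 0"
      using rel by (rule min_balanced_relation_nonpos[OF mb bal _ S(1)])
    ultimately show "c v = 0" using S by simp
  qed simp
  then obtain g where g: "linear g" "\<And>v. v \<in> incidence ` \<B> \<Longrightarrow> g v = f (the_inv incidence v)"
    using linear_independent_extend[of "incidence ` \<B>" "\<lambda>v. f (the_inv incidence v)"] by auto
  have "adjoint g 1 \<bullet> incidence S = f S" if "S \<in> \<B>" for S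
    using adjoint_works[OF g(1), of "incidence S" 1] g(2) that
    by (simp add: inner_commute the_inv_f_f[OF inj_incidence])
  then show ?thesis using that by blast
qed

text \<open>A player outside \<open>M\<close> absorbs the change of the total, invisibly to subsets
  of \<open>M\<close>.\<close>

lemma extend_outside:
  fixes M :: "'n::finite set"
  assumes "M \<subset> UNIV"
  obtains y where "y \<bullet> incidence UNIV = a" "\<And>S. S \<subseteq> M \<Longrightarrow> y \<bullet> incidence S = x \<bullet> incidence S"
proof -
  obtain j where j: "j \<notin> M" using assms by auto
  define y where "y = x + axis j (a - x \<bullet> incidence UNIV)"
  have y: "y \<bullet> incidence S = x \<bullet> incidence S + (if j \<in> S then a - x \<bullet> incidence UNIV else 0)" for S
    by (simp add: y_def inner_add_left inner_axis' incidence_def)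
  show ?thesis by (rule that[of y]) (use y j in auto)
qed

text \<open>Irreducibility enters only here, through Farkas' lemma.\<close>

lemma irreducible_separation:
  fixes M :: "'n::finite set"
  assumes nt: "nontrivial_system M \<B>" and irr: "\<not> reducible_on M \<B>"
    and T: "T \<noteq> {}" "T \<subset> M" "T \<notin> \<B>"
  obtains y where "\<And>S. S \<in> \<B> \<Longrightarrow> 0 < y \<bullet> incidence S" "y \<bullet> incidence T < 0"
proof -
  \<comment> \<open>The hull used below is closed and can be separated from a point, while
    membership in \<open>C\<close> exhibits coefficients, which irreducibility rules out for
    \<open>T\<close>.\<close>
  define C where "C = {(\<Sum>S\<in>\<B>. c S *\<^sub>R incidence S) |c. \<forall>S\<in>\<B>. 0 \<le> (c S :: real)}"
  have "convex_cone C"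
    unfolding convex_cone_iff
  proof (intro conjI ballI allI impI)
    show "0 \<in> C" unfolding C_def by (intro CollectI exI[of _ "\<lambda>_. 0"]) simp
  next
    fix v w assume "v \<in> C" "w \<in> C"
    then obtain c c' where "v = (\<Sum>S\<in>\<B>. c S *\<^sub>R incidence S)" "\<forall>S\<in>\<B>. 0 \<le> c S"
      "w = (\<Sum>S\<in>\<B>. c' S *\<^sub>R incidence S)" "\<forall>S\<in>\<B>. 0 \<le> c' S"
      unfolding C_def by blast
    then show "v + w \<in> C" unfolding C_def
      by (intro CollectI exI[of _ "\<lambda>S. c S + c' S"]) (simp add: scaleR_add_left sum.distrib)
  next
    fix v and k :: real assume "v \<in> C" "0 \<le> k"
    then obtain c where "v = (\<Sum>S\<in>\<B>. c S *\<^sub>R incidence S)" "\<forall>S\<in>\<B>. 0 \<le> c S"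
      unfolding C_def by blast
    then show "k *\<^sub>R v \<in> C" using \<open>0 \<le> k\<close> unfolding C_def
      by (intro CollectI exI[of _ "\<lambda>S. k * c S"]) (simp add: scaleR_sum_right)
  qed
  moreover have "incidence ` \<B> \<subseteq> C"
  proof
    fix v assume "v \<in> incidence ` \<B>"
    then obtain S where "S \<in> \<B>" "v = incidence S" by auto
    moreover have "(\<Sum>R\<in>\<B>. (if R = S then 1 else 0) *\<^sub>R incidence R)
        = (\<Sum>R\<in>\<B>. if R = S then incidence S else 0)"
      by (rule sum.cong) auto
    ultimately show "v \<in> C" unfolding C_def
      by (intro CollectI exI[of _ "\<lambda>R. if R = S then 1 else 0"]) auto
  qed
  ultimately have hullC: "convex_cone hull (incidence ` \<B>) \<subseteq> C"
    by (intro hull_minimal)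
  have "incidence T \<notin> C"
  proof
    assume "incidence T \<in> C"
    then obtain c where c: "incidence T = (\<Sum>S\<in>\<B>. c S *\<^sub>R incidence S)" "\<forall>S\<in>\<B>. 0 \<le> c S"
      unfolding C_def by blast
    \<comment> \<open>A player of \<open>S\<close> outside \<open>T\<close> has coordinate 0 in
      \<open>incidence T\<close>, so the nonnegative contributions there all vanish. As
      \<open>T\<close> is not in \<open>\<B>\<close>, only strict subsets of \<open>T\<close> keep a
      weight.\<close>
    have "c S = 0" if S: "S \<in> \<B>" "\<not> S \<subset> T" for S
    proof -
      obtain i where i: "i \<in> S" "i \<notin> T" using S T(3) by blast
      have "0 = incidence T $ i" using i by (simp add: incidence_def)
      also have "\<dots> = (\<Sum>S\<in>\<B>. c S * indicator S i)"
        unfolding c(1) by (simp add: incidence_def)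
      finally have "\<forall>S\<in>\<B>. c S * indicator S i = 0"
        using c(2) by (subst (asm) eq_commute, subst (asm) sum_nonneg_eq_0_iff) auto
      then show ?thesis using S(1) i(1) by fastforce
    qed
    then have "(\<Sum>S\<in>{S \<in> \<B>. S \<subset> T}. c S *\<^sub>R incidence S) = (\<Sum>S\<in>\<B>. c S *\<^sub>R incidence S)"
      by (intro sum.mono_neutral_left) auto
    then have "reducible_on M \<B>"
      unfolding reducible_on_def using T c by (intro exI[of _ T] conjI exI[of _ c]) auto
    then show False using irr by blast
  qed
  then have "incidence T \<notin> convex_cone hull (incidence ` \<B>)" using hullC by blast
  then obtain y b where y: "y \<bullet> incidence T < b"
      "\<And>v. v \<in> convex_cone hull (incidence ` \<B>) \<Longrightarrow> b < y \<bullet> v"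
    using separating_hyperplane_closed_point[of "convex_cone hull (incidence ` \<B>)" "incidence T"]
    by (auto simp: convex_convex_cone_hull closed_convex_cone_hull)
  have "b < 0" using y(2)[OF convex_cone_hull_contains_0] by simp
  \<comment> \<open>A negative value on a member could be scaled along its ray to exactly
    \<open>b\<close>, which the strict separation forbids.\<close>
  have nonneg: "0 \<le> y \<bullet> incidence S" if "S \<in> \<B>" for S
  proof (rule ccontr)
    assume "\<not> 0 \<le> y \<bullet> incidence S"
    then have neg: "y \<bullet> incidence S < 0" by simp
    have "incidence S \<in> convex_cone hull (incidence ` \<B>)" using that by (simp add: hull_inc)
    then have "b < y \<bullet> ((b / (y \<bullet> incidence S)) *\<^sub>R incidence S)"
      using \<open>b < 0\<close> neg by (intro y(2) convex_cone_hull_mul) (auto simp: divide_nonpos_neg)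
    then show False using neg by simp
  qed
  \<comment> \<open>Adding \<open>\<delta>\<close> to every coordinate makes the nonnegative values
    on the nonempty members positive, while this choice merely halves the negative value at
    \<open>T\<close>.\<close>
  define \<delta> where "\<delta> = - (y \<bullet> incidence T) / (2 * real (card T))"
  have cT: "real (card T) > 0" using T by (simp add: card_gt_0_iff)
  have "\<delta> > 0" using y(1) \<open>b < 0\<close> cT by (simp add: \<delta>_def divide_neg_pos)
  have one: "(y + \<delta> *\<^sub>R 1) \<bullet> incidence S = y \<bullet> incidence S + \<delta> * real (card S)" for S
    by (simp add: inner_add_left inner_incidence[of 1])
  show ?thesis
  proof (rule that[of "y + \<delta> *\<^sub>R 1"])
    fix S assume S: "S \<in> \<B>"
    then have "S \<noteq> {}" using nt by (auto simp: nontrivial_system_def)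
    then show "0 < (y + \<delta> *\<^sub>R 1) \<bullet> incidence S"
      using nonneg[OF S] \<open>\<delta> > 0\<close> by (simp add: one card_gt_0_iff add_nonneg_pos)
  next
    have "\<delta> * real (card T) = - (y \<bullet> incidence T) / 2"
      using cT by (simp add: \<delta>_def)
    then show "(y + \<delta> *\<^sub>R 1) \<bullet> incidence T < 0"
      using y(1) \<open>b < 0\<close> unfolding one by linarith
  qed
qed

lemma incidence_inner_incidence: "incidence A \<bullet> incidence S = real (card (A \<inter> S))"
proof -
  have "incidence A \<bullet> incidence S = (\<Sum>i\<in>S. if i \<in> A then 1 else 0)"
    unfolding inner_incidence by (rule sum.cong) (auto simp: incidence_def)
  then show ?thesis by (simp add: sum.If_cases Int_commute)
qed

text \<open>Each player of \<open>M\<close>, and some \<open>k\<close> outside \<open>T\<close>,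
  receives 1, and a player \<open>j\<close> of \<open>T\<close> outside \<open>M\<close> pays the
  total. \<open>T\<close> contains \<open>j\<close> but not \<open>k\<close>, so it receives less
  than it pays; members of \<open>\<B>\<close> avoid \<open>j\<close>.\<close>

lemma separation_outside:
  fixes M :: "'n::finite set"
  assumes nt: "nontrivial_system M \<B>" and T: "T \<noteq> UNIV" "\<not> T \<subseteq> M"
  obtains y where "y \<bullet> incidence UNIV = 0" "\<And>S. S \<in> \<B> \<Longrightarrow> 0 < y \<bullet> incidence S"
    "y \<bullet> incidence T < 0"
proof -
  obtain j where j: "j \<in> T" "j \<notin> M" using T by auto
  obtain k where k: "k \<notin> T" using T by auto
  define y where "y = incidence (insert k M) - axis j (real (card (insert k M)))"
  have y: "y \<bullet> incidence S = real (card (insert k M \<inter> S)) - (if j \<in> S then real (card (insert k M)) else 0)"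
    for S
    by (simp add: y_def inner_diff_left inner_axis' incidence_inner_incidence)
      (simp add: incidence_def)
  show ?thesis
  proof (rule that[of y])
    show "y \<bullet> incidence UNIV = 0" by (simp add: y)
    fix S assume "S \<in> \<B>"
    then have "S \<subseteq> M" "S \<noteq> {}" using nt by (auto simp: nontrivial_system_def)
    then show "0 < y \<bullet> incidence S" using j by (auto simp: y card_gt_0_iff)
  next
    have "insert k M \<inter> T \<subset> insert k M" using k by auto
    then have "card (insert k M \<inter> T) < card (insert k M)" by (intro psubset_card_mono) auto
    then show "y \<bullet> incidence T < 0" using j by (simp add: y)
  qed
qed

lemma separation:
  fixes M :: "'n::finite set"
  assumes nt: "nontrivial_system M \<B>" and irr: "\<not> reducible_on M \<B>" and M: "M \<subset> UNIV"
    and T: "T \<noteq> {}" "T \<noteq> UNIV" "T \<noteq> M" "T \<notin> \<B>"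
  shows "\<exists>y. y \<bullet> incidence UNIV = 0 \<and> (\<forall>S\<in>\<B>. 0 < y \<bullet> incidence S) \<and> y \<bullet> incidence T < 0"
proof (cases "T \<subseteq> M")
  case True
  obtain x where x: "\<And>S. S \<in> \<B> \<Longrightarrow> 0 < x \<bullet> incidence S" "x \<bullet> incidence T < 0"
    using irreducible_separation[OF nt irr, of T] T True by blast
  obtain y where "y \<bullet> incidence UNIV = 0" "\<And>S. S \<subseteq> M \<Longrightarrow> y \<bullet> incidence S = x \<bullet> incidence S"
    using extend_outside[OF M] by blast
  moreover have "S \<subseteq> M" if "S \<in> \<B>" for S using nt that by (auto simp: nontrivial_system_def)
  ultimately show ?thesis using x True by metis
next
  case False
  show ?thesis by (rule separation_outside[OF nt T(2) False]) blast
qed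

text \<open>A strict subset of \<open>M\<close> misses some player of \<open>M\<close>, so no
  multiple of its incidence vector balances \<open>M\<close>. The resulting second member of
  \<open>\<B>\<close> is what makes \<open>M\<close> slack in
  \<open>tight_at_member\<close>.\<close>

lemma nontrivial_not_singleton:
  assumes nt: "nontrivial_system M \<B>" and bal: "balancing_coeffs M \<B> \<gamma>"
  shows "\<B> \<noteq> {S}"
proof
  assume "\<B> = {S}"
  then have S: "S \<subset> M" "S \<noteq> {}" "\<gamma> S *\<^sub>R incidence S = incidence M"
    using nt bal by (auto simp: nontrivial_system_def balancing_coeffs_def)
  then obtain i where "i \<in> M" "i \<notin> S" by blast
  then show False using arg_cong[OF S(3), of "\<lambda>v. v $ i"] by (simp add: incidence_def)
qed

section \<open>A game in the relative interior of the facet\<close>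

text \<open>Interpolation prescribes 0 at \<open>R\<close> and 1 at the other members; a player
  outside \<open>M\<close> brings the total to 0. The value at \<open>M\<close> is then a weighted
  sum of these, with positive weights.\<close>

lemma tight_at_member:
  fixes M :: "'n::finite set"
  assumes M: "M \<subset> UNIV" and mb: "min_balanced_on M \<B>" and bal: "balancing_coeffs M \<B> \<gamma>"
    and R: "R \<in> \<B>"
  obtains y where "y \<bullet> incidence UNIV = 0" "y \<bullet> incidence R = 0" "0 < y \<bullet> incidence M"
    "\<And>S. S \<in> \<B> \<Longrightarrow> S \<noteq> R \<Longrightarrow> 0 < y \<bullet> incidence S"
proof -
  have nt: "nontrivial_system M \<B>" using mb by (simp add: min_balanced_on_def balanced_on_def)
  then have sub: "S \<subseteq> M" if "S \<in> \<B>" for S using that by (auto simp: nontrivial_system_def)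
  obtain p where p: "\<And>S. S \<in> \<B> \<Longrightarrow> p \<bullet> incidence S = (if S = R then 0 else 1)"
    using min_balanced_interpolation[OF mb bal, where f = "\<lambda>S. if S = R then 0 else 1"] by blast
  obtain y where y: "y \<bullet> incidence UNIV = 0" "\<And>S. S \<subseteq> M \<Longrightarrow> y \<bullet> incidence S = p \<bullet> incidence S"
    using extend_outside[OF M] by blast
  have yB: "y \<bullet> incidence S = (if S = R then 0 else 1)" if "S \<in> \<B>" for S
    using that y(2)[OF sub] p by simp
  obtain R' where R': "R' \<in> \<B>" "R' \<noteq> R"
    using nontrivial_not_singleton[OF nt bal, of R] R by blast
  have pos: "0 < \<gamma> S" if "S \<in> \<B>" for S using bal that by (simp add: balancing_coeffs_def)
  have "0 < \<gamma> R' * (y \<bullet> incidence R')" using R' pos by (simp add: yB)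
  moreover have "\<dots> \<le> (\<Sum>S\<in>\<B>. \<gamma> S * (y \<bullet> incidence S))"
    using R' pos by (intro member_le_sum) (auto simp: yB less_imp_le)
  ultimately have "0 < y \<bullet> incidence M" unfolding balancing_inner[OF bal] by linarith
  then show ?thesis using that y(1) yB R by simp
qed

lemma tight_game_exists:
  fixes M :: "'n::finite set"
  assumes M: "M \<subset> UNIV" and irr: "irreducible_min_balanced_on M \<B>"
    and bal: "balancing_coeffs M \<B> \<gamma>"
  obtains m where "m $ {} = 0" "m $ UNIV = 0" "m $ M = 0" "\<And>S. S \<in> \<B> \<Longrightarrow> m $ S = 0"
    "\<And>T. T \<notin> \<B> \<Longrightarrow> T \<noteq> {} \<Longrightarrow> T \<noteq> UNIV \<Longrightarrow> T \<noteq> M \<Longrightarrow> m $ T < 0"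
    "\<And>U. U \<noteq> {} \<Longrightarrow> U \<noteq> UNIV \<Longrightarrow> U \<noteq> M \<Longrightarrow> \<exists>x. x \<bullet> incidence UNIV = 0 \<and> x \<bullet> incidence U = m $ U \<and>
       (\<forall>T. T \<noteq> {} \<longrightarrow> T \<noteq> UNIV \<longrightarrow> T \<noteq> U \<longrightarrow> m $ T < x \<bullet> incidence T)"
proof -
  define Z where "Z = {{}, UNIV, M} \<union> \<B>"
  have mb: "min_balanced_on M \<B>" and red: "\<not> reducible_on M \<B>"
    using irr by (simp_all add: irreducible_min_balanced_on_def)
  then have nt: "nontrivial_system M \<B>" by (simp add: min_balanced_on_def balanced_on_def)
  then have ne: "\<B> \<noteq> {}" by (simp add: nontrivial_system_def)
  have pos: "0 < \<gamma> S" if "S \<in> \<B>" for S using bal that by (simp add: balancing_coeffs_def)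
  have posM: "0 < y \<bullet> incidence M" if "\<And>S. S \<in> \<B> \<Longrightarrow> 0 < y \<bullet> incidence S" for y
    unfolding balancing_inner[OF bal] using ne pos that by (intro sum_pos) auto
  obtain y where y: "\<And>T. T \<notin> Z \<Longrightarrow> y T \<bullet> incidence UNIV = 0"
      "\<And>T S. T \<notin> Z \<Longrightarrow> S \<in> \<B> \<Longrightarrow> 0 < y T \<bullet> incidence S"
      "\<And>T. T \<notin> Z \<Longrightarrow> y T \<bullet> incidence T < 0"
  proof -
    have "\<forall>T. \<exists>y. T \<notin> Z \<longrightarrow>
        y \<bullet> incidence UNIV = 0 \<and> (\<forall>S\<in>\<B>. 0 < y \<bullet> incidence S) \<and> y \<bullet> incidence T < 0"
      using separation[OF nt red M] unfolding Z_def by blast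
    then show ?thesis using that by (metis (no_types))
  qed
  \<comment> \<open>\<open>\<tau> T\<close> will index a separating vector whose value at
    \<open>T\<close> is smallest, so the lower envelope of these vectors is attained.\<close>
  have "\<forall>T\<in>-Z. \<exists>\<tau>\<in>-Z. \<forall>U\<in>-Z. y \<tau> \<bullet> incidence T \<le> y U \<bullet> incidence T"
  proof
    fix T assume "T \<in> - Z"
    then have "Min ((\<lambda>U. y U \<bullet> incidence T) ` (- Z)) \<in> (\<lambda>U. y U \<bullet> incidence T) ` (- Z)"
      by (intro Min_in) auto
    then obtain \<tau> where "\<tau> \<in> - Z" "y \<tau> \<bullet> incidence T = Min ((\<lambda>U. y U \<bullet> incidence T) ` (- Z))"
      by auto
    then show "\<exists>\<tau>\<in>-Z. \<forall>U\<in>-Z. y \<tau> \<bullet> incidence T \<le> y U \<bullet> incidence T"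
      by (intro bexI[of _ \<tau>]) (auto intro: Min_le)
  qed
  then obtain \<tau> where \<tau>: "\<And>T. T \<notin> Z \<Longrightarrow> \<tau> T \<notin> Z"
      "\<And>T U. T \<notin> Z \<Longrightarrow> U \<notin> Z \<Longrightarrow> y (\<tau> T) \<bullet> incidence T \<le> y U \<bullet> incidence T"
    by (metis ComplD ComplI)
  \<comment> \<open>\<open>\<epsilon>\<close> is taken so small that adding any tilt keeps the
    separating vectors positive on \<open>\<B>\<close>, and thereby on \<open>M\<close>.\<close>
  have "\<forall>\<^sub>F \<epsilon> in at_right 0. T \<notin> Z \<longrightarrow> S \<in> \<B> \<longrightarrow> 0 < (y T + \<epsilon> *\<^sub>R tilt U) \<bullet> incidence S" for T S U
  proof (cases "T \<notin> Z \<and> S \<in> \<B>")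
    case True
    have "((\<lambda>\<epsilon>. (y T + \<epsilon> *\<^sub>R tilt U) \<bullet> incidence S) \<longlongrightarrow> (y T + 0 *\<^sub>R tilt U) \<bullet> incidence S) (at_right 0)"
      by (intro tendsto_intros)
    then have "\<forall>\<^sub>F \<epsilon> in at_right 0. 0 < (y T + \<epsilon> *\<^sub>R tilt U) \<bullet> incidence S"
      using True y(2) by (intro order_tendstoD) auto
    then show ?thesis by (rule eventually_mono) simp
  qed auto
  then have "\<forall>\<^sub>F \<epsilon> in at_right 0. \<forall>T S U. T \<notin> Z \<longrightarrow> S \<in> \<B> \<longrightarrow> 0 < (y T + \<epsilon> *\<^sub>R tilt U) \<bullet> incidence S"
    by (intro eventually_all_finite)
  then have "\<forall>\<^sub>F \<epsilon> in at_right 0. 0 < \<epsilon> \<and>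
      (\<forall>T S U. T \<notin> Z \<longrightarrow> S \<in> \<B> \<longrightarrow> 0 < (y T + \<epsilon> *\<^sub>R tilt U) \<bullet> incidence S)"
    using eventually_at_right_less[of "0::real"] by eventually_elim simp
  then obtain \<epsilon> :: real where "0 < \<epsilon>"
      and \<epsilon>: "\<And>T S U. T \<notin> Z \<Longrightarrow> S \<in> \<B> \<Longrightarrow> 0 < (y T + \<epsilon> *\<^sub>R tilt U) \<bullet> incidence S"
    using eventually_happens' trivial_limit_at_right_real by blast
  define m :: "real ^ 'n set" where
    "m = (\<chi> T. if T \<in> Z then 0 else y (\<tau> T) \<bullet> incidence T + \<epsilon> * quad_game $ T)"
  have mZ: "m $ T = 0" if "T \<in> Z" for T using that by (simp add: m_def)
  have neg: "m $ T < 0" if "T \<notin> Z" for T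
  proof -
    have "\<epsilon> * quad_game $ T < 0"
      using \<open>0 < \<epsilon>\<close> that by (intro mult_pos_neg quad_game_neg) (auto simp: Z_def)
    \<comment> \<open>The envelope at \<open>T\<close> is at most the value of the vector separating
      \<open>T\<close> itself, which is negative.\<close>
    then show ?thesis using \<tau>(2)[OF that that] y(3)[OF that] that by (simp add: m_def)
  qed
  show ?thesis
  proof (rule that[of m])
    fix U assume U: "U \<noteq> {}" "U \<noteq> UNIV" "U \<noteq> M"
    show "\<exists>x. x \<bullet> incidence UNIV = 0 \<and> x \<bullet> incidence U = m $ U \<and>
       (\<forall>T. T \<noteq> {} \<longrightarrow> T \<noteq> UNIV \<longrightarrow> T \<noteq> U \<longrightarrow> m $ T < x \<bullet> incidence T)"
    proof (cases "U \<in> \<B>")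
      case True
      \<comment> \<open>Among the sets of \<open>Z\<close> other than \<open>{}\<close> and the full
        set, \<open>z\<close> is tight only at \<open>U\<close>. A small multiple of it also stays
        above the negative values of \<open>m\<close> off \<open>Z\<close>.\<close>
      obtain z where z: "z \<bullet> incidence UNIV = 0" "z \<bullet> incidence U = 0" "0 < z \<bullet> incidence M"
          "\<And>S. S \<in> \<B> \<Longrightarrow> S \<noteq> U \<Longrightarrow> 0 < z \<bullet> incidence S"
        using tight_at_member[OF M mb bal True] by blast
      have "\<forall>\<^sub>F \<delta> in at_right 0. T \<notin> Z \<longrightarrow> m $ T < (\<delta> *\<^sub>R z) \<bullet> incidence T" for T
      proof (cases "T \<in> Z")
        case False
        have "((\<lambda>\<delta>. (\<delta> *\<^sub>R z) \<bullet> incidence T) \<longlongrightarrow> (0 *\<^sub>R z) \<bullet> incidence T) (at_right 0)"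
          by (intro tendsto_intros)
        then have "\<forall>\<^sub>F \<delta> in at_right 0. m $ T < (\<delta> *\<^sub>R z) \<bullet> incidence T"
          using neg[OF False] by (intro order_tendstoD) auto
        then show ?thesis by (rule eventually_mono) simp
      qed auto
      then have "\<forall>\<^sub>F \<delta> in at_right 0. \<forall>T. T \<notin> Z \<longrightarrow> m $ T < (\<delta> *\<^sub>R z) \<bullet> incidence T"
        by (intro eventually_all_finite)
      then have "\<forall>\<^sub>F \<delta> in at_right 0. 0 < \<delta> \<and> (\<forall>T. T \<notin> Z \<longrightarrow> m $ T < (\<delta> *\<^sub>R z) \<bullet> incidence T)"
        using eventually_at_right_less[of "0::real"] by eventually_elim simp
      then obtain \<delta> :: real where "0 < \<delta>" and \<delta>: "\<And>T. T \<notin> Z \<Longrightarrow> m $ T < (\<delta> *\<^sub>R z) \<bullet> incidence T"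
        using eventually_happens' trivial_limit_at_right_real by blast
      have "m $ T < (\<delta> *\<^sub>R z) \<bullet> incidence T" if T: "T \<noteq> {}" "T \<noteq> UNIV" "T \<noteq> U" for T
      proof (cases "T \<in> Z")
        case True
        then have "0 < z \<bullet> incidence T" using T z by (auto simp: Z_def)
        then show ?thesis using \<open>0 < \<delta>\<close> mZ[OF True] by simp
      qed (rule \<delta>)
      moreover have "m $ U = 0" using True by (intro mZ) (simp add: Z_def)
      ultimately show ?thesis using z by (intro exI[of _ "\<delta> *\<^sub>R z"]) simp
    next
      case False
      then have UZ: "U \<notin> Z" using U by (simp add: Z_def)
      \<comment> \<open>Both summands are tight at \<open>U\<close>: \<open>\<tau> U\<close> attains
        the envelope there and the tilt meets \<open>quad_game\<close>. At other sets off
        \<open>Z\<close> the tilt is strictly larger; on \<open>\<B>\<close> and \<open>M\<close>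
        the choice of \<open>\<epsilon>\<close> makes \<open>x\<close> positive.\<close>
      define x where "x = y (\<tau> U) + \<epsilon> *\<^sub>R tilt U"
      have "m $ T < x \<bullet> incidence T" if T: "T \<noteq> {}" "T \<noteq> UNIV" "T \<noteq> U" for T
      proof (cases "T \<in> Z")
        case True
        have "0 < x \<bullet> incidence S" if "S \<in> \<B>" for S
          unfolding x_def using \<epsilon> \<tau>(1)[OF UZ] that by blast
        then have "0 < x \<bullet> incidence T" using posM[of x] True T by (auto simp: Z_def)
        then show ?thesis using mZ[OF True] by simp
      next
        case False
        have "\<epsilon> * quad_game $ T < \<epsilon> * (tilt U \<bullet> incidence T)"
          using tilt_greater_quad[OF T] \<open>0 < \<epsilon>\<close> by simp
        then show ?thesis
          using \<tau>(2)[OF False \<tau>(1)[OF UZ]] False by (simp add: m_def x_def inner_add_left)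
      qed
      moreover have "x \<bullet> incidence U = m $ U"
        using UZ by (simp add: x_def m_def inner_add_left tilt_self)
      moreover have "x \<bullet> incidence UNIV = 0"
        using y(1)[OF \<tau>(1)[OF UZ]] by (simp add: x_def inner_add_left tilt_UNIV)
      ultimately show ?thesis by blast
    qed
  next
    fix T assume "T \<notin> \<B>" "T \<noteq> {}" "T \<noteq> UNIV" "T \<noteq> M"
    then show "m $ T < 0" by (intro neg) (simp add: Z_def)
  qed (rule mZ, simp add: Z_def)+
qed

section \<open>The facets\<close>

text \<open>For a core element \<open>x\<close> of the restriction to \<open>M\<close>, the weighted
  bounds on the members add up to \<open>x \<bullet> incidence M = m $ M\<close>.\<close>

lemma assigned_ineq_valid:
  fixes M :: "'n::finite set"
  assumes nt: "nontrivial_system M \<B>" and bal: "balancing_coeffs M \<B> \<gamma>"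
    and m: "m \<in> totally_balanced_cone"
  shows "0 \<le> assigned_ineq M \<B> \<gamma> \<bullet> m"
proof -
  have "M \<noteq> {}" using nt by (auto simp: nontrivial_system_def)
  then obtain x where x: "x \<bullet> incidence M = m $ M" "\<And>T. T \<subseteq> M \<Longrightarrow> m $ T \<le> x \<bullet> incidence T"
    using m unfolding totally_balanced_cone_iff by meson
  have "(\<Sum>S\<in>\<B>. \<gamma> S * m $ S) \<le> (\<Sum>S\<in>\<B>. \<gamma> S * (x \<bullet> incidence S))"
    using nt bal by (intro sum_mono mult_left_mono x(2))
      (auto simp: nontrivial_system_def balancing_coeffs_def less_imp_le)
  also have "\<dots> = m $ M" using balancing_inner[OF bal, of x] x(1) by simp
  finally show ?thesis
    using m by (simp add: assigned_ineq_inner[OF nt] game_def totally_balanced_cone_iff)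
qed

text \<open>\<open>tilt M\<close> is tight at \<open>M\<close> and strictly slack at every member of
  \<open>\<B>\<close>, so the weighted sum of the core bounds is strict.\<close>

lemma assigned_ineq_quad_game:
  fixes M :: "'n::finite set"
  assumes nt: "nontrivial_system M \<B>" and bal: "balancing_coeffs M \<B> \<gamma>"
  shows "0 < assigned_ineq M \<B> \<gamma> \<bullet> quad_game"
proof -
  have "(\<Sum>S\<in>\<B>. \<gamma> S * quad_game $ S) < (\<Sum>S\<in>\<B>. \<gamma> S * (tilt M \<bullet> incidence S))"
    using nt bal by (intro sum_strict_mono mult_strict_left_mono tilt_greater_quad)
      (auto simp: nontrivial_system_def balancing_coeffs_def)
  also have "\<dots> = quad_game $ M" using balancing_inner[OF bal, of "tilt M"] tilt_self by metis
  finally show ?thesis by (simp add: assigned_ineq_inner[OF nt] game_def)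
qed

lemma assigned_ineq_perturbation:
  fixes M :: "'n::finite set"
  assumes M: "M \<subset> UNIV" and irr: "irreducible_min_balanced_on M \<B>"
    and bal: "balancing_coeffs M \<B> \<gamma>"
  obtains m where "m \<in> exact_cone" "assigned_ineq M \<B> \<gamma> \<bullet> m = 0"
    "\<And>d. d $ {} = 0 \<Longrightarrow> assigned_ineq M \<B> \<gamma> \<bullet> d = 0 \<Longrightarrow> \<exists>\<epsilon>>0. m + \<epsilon> *\<^sub>R d \<in> exact_cone"
proof -
  have mb: "min_balanced_on M \<B>" using irr by (simp add: irreducible_min_balanced_on_def)
  then have nt: "nontrivial_system M \<B>" by (simp add: min_balanced_on_def balanced_on_def)
  have sub: "S \<subseteq> M" if "S \<in> \<B>" for S using nt that by (auto simp: nontrivial_system_def)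
  obtain m :: "real ^ 'n set" where m: "m $ {} = 0" "m $ UNIV = 0" "m $ M = 0" "\<And>S. S \<in> \<B> \<Longrightarrow> m $ S = 0"
    "\<And>T. T \<notin> \<B> \<Longrightarrow> T \<noteq> {} \<Longrightarrow> T \<noteq> UNIV \<Longrightarrow> T \<noteq> M \<Longrightarrow> m $ T < 0"
    "\<And>U. U \<noteq> {} \<Longrightarrow> U \<noteq> UNIV \<Longrightarrow> U \<noteq> M \<Longrightarrow> \<exists>x. x \<bullet> incidence UNIV = 0 \<and> x \<bullet> incidence U = m $ U \<and>
       (\<forall>T. T \<noteq> {} \<longrightarrow> T \<noteq> UNIV \<longrightarrow> T \<noteq> U \<longrightarrow> m $ T < x \<bullet> incidence T)"
    using tight_game_exists[OF M irr bal] by blast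
  have zero: "assigned_ineq M \<B> \<gamma> \<bullet> m = 0"
    using m by (simp add: assigned_ineq_inner[OF nt] game_def)
  have perturb: "\<exists>\<epsilon>>0. m + \<epsilon> *\<^sub>R d \<in> exact_cone"
    if d: "d $ {} = 0" "assigned_ineq M \<B> \<gamma> \<bullet> d = 0" for d
  proof (rule exact_perturbation[OF m(1) d(1)])
    fix S :: "'n set"
    show "\<exists>x p. x \<bullet> incidence UNIV = m $ UNIV \<and> p \<bullet> incidence UNIV = d $ UNIV \<and>
        x \<bullet> incidence S = m $ S \<and> p \<bullet> incidence S = d $ S \<and>
        (\<forall>T. m $ T < x \<bullet> incidence T \<or> m $ T = x \<bullet> incidence T \<and> d $ T = p \<bullet> incidence T)"
    proof (cases "S \<in> {{}, UNIV, M}")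
      case True
      \<comment> \<open>The core element is 0 here, which is tight wherever \<open>m\<close>
        vanishes, so \<open>p\<close> has to match \<open>d\<close> on \<open>\<B>\<close>,
        \<open>M\<close> and the full set at once.\<close>
      obtain q where q: "\<And>S. S \<in> \<B> \<Longrightarrow> q \<bullet> incidence S = d $ S"
        using min_balanced_interpolation[OF mb bal, where f = "\<lambda>S. d $ S"] by blast
      obtain p where p: "p \<bullet> incidence UNIV = d $ UNIV"
          "\<And>S. S \<subseteq> M \<Longrightarrow> p \<bullet> incidence S = q \<bullet> incidence S"
        using extend_outside[OF M] by blast
      have pB: "p \<bullet> incidence S = d $ S" if "S \<in> \<B>" for S using that p(2) sub q by simp
      \<comment> \<open>The value of \<open>p\<close> at \<open>M\<close> is forced by the values on
        \<open>\<B>\<close>; it agrees with \<open>d\<close> because \<open>d\<close> lies on the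
        hyperplane.\<close>
      have "p \<bullet> incidence M = (\<Sum>S\<in>\<B>. \<gamma> S * d $ S)"
        unfolding balancing_inner[OF bal] by (rule sum.cong) (simp_all add: pB)
      also have "\<dots> = d $ M" using d by (simp add: assigned_ineq_inner[OF nt] game_def)
      finally have pM: "p \<bullet> incidence M = d $ M" .
      have "m $ T < 0 \<or> m $ T = 0 \<and> d $ T = p \<bullet> incidence T" for T
        using m(1-4) m(5)[of T] p(1) pM pB d(1)
        by (cases "T \<in> \<B> \<or> T = {} \<or> T = UNIV \<or> T = M") auto
      then show ?thesis using True m(1-3) p(1) pM d(1) by (intro exI[of _ 0] exI[of _ p]) auto
    next
      case False
      then obtain x where x: "x \<bullet> incidence UNIV = 0" "x \<bullet> incidence S = m $ S"
          "\<And>T. T \<noteq> {} \<Longrightarrow> T \<noteq> UNIV \<Longrightarrow> T \<noteq> S \<Longrightarrow> m $ T < x \<bullet> incidence T"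
        using m(6)[of S] by auto
      obtain i where i: "i \<in> S" using False by auto
      \<comment> \<open>As \<open>x\<close> is tight only at \<open>S\<close> and the trivial sets,
        \<open>p\<close> has to meet just the values at \<open>S\<close> and the full set: one
        player inside \<open>S\<close> and one outside suffice.\<close>
      define q where "q = axis i (d $ S)"
      have q: "q \<bullet> incidence S = d $ S"
        using i by (simp add: q_def inner_axis' incidence_def)
      have "S \<subset> UNIV" using False by auto
      then obtain p where p: "p \<bullet> incidence UNIV = d $ UNIV"
          "\<And>T. T \<subseteq> S \<Longrightarrow> p \<bullet> incidence T = q \<bullet> incidence T"
        using extend_outside by blast
      have pS: "p \<bullet> incidence S = d $ S" using p(2) q by simp
      have "m $ T < x \<bullet> incidence T \<or> m $ T = x \<bullet> incidence T \<and> d $ T = p \<bullet> incidence T" for T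
        using x p(1) pS m(1,2) d(1) by (cases "T = {} \<or> T = UNIV \<or> T = S") auto
      then show ?thesis using x p(1) pS m(2) by (intro exI[of _ x] exI[of _ p]) auto
    qed
  qed
  have "m \<in> exact_cone" using perturb[of 0] by simp
  then show ?thesis using that zero perturb by blast
qed

theorem mainTheorem4:
  fixes M :: "'n::finite set" and \<B> :: "'n set set" and \<gamma> :: "'n set \<Rightarrow> real"
  assumes "CARD('n) \<ge> 3"
    and "M \<subset> UNIV" and "card M \<ge> 2"
    and "irreducible_min_balanced_on M \<B>"
    and "balancing_coeffs M \<B> \<gamma>"
  shows "facet_defining (assigned_ineq M \<B> \<gamma>) totally_balanced_cone
    \<and> facet_defining (assigned_ineq M \<B> \<gamma>) exact_cone
    \<and> facet_defining (conjugate_ineq (assigned_ineq M \<B> \<gamma>)) exact_cone"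
proof -
  let ?\<theta> = "assigned_ineq M \<B> \<gamma>"
  define W where "W = {d :: real ^ 'n set. d $ {} = 0}"
  have W: "subspace W" by (auto simp: W_def subspace_def)
  have nt: "nontrivial_system M \<B>"
    using assms(4) by (simp add: irreducible_min_balanced_on_def min_balanced_on_def balanced_on_def)
  obtain m where m: "m \<in> exact_cone" "?\<theta> \<bullet> m = 0"
    "\<And>d. d $ {} = 0 \<Longrightarrow> ?\<theta> \<bullet> d = 0 \<Longrightarrow> \<exists>\<epsilon>>0. m + \<epsilon> *\<^sub>R d \<in> exact_cone"
    using assigned_ineq_perturbation[OF assms(2,4,5)] by blast
  \<comment> \<open>One argument covers both cones: the perturbations stay in the smaller cone, and
    validity holds on the larger one.\<close>
  have facet: "facet_defining ?\<theta> K"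
    if K: "convex K" "exact_cone \<subseteq> K" "K \<subseteq> totally_balanced_cone" for K
  proof (rule facet_defining_criterion[OF K(1) W])
    show "K \<subseteq> W" using K(3) by (auto simp: W_def totally_balanced_cone_iff)
    show "0 \<le> ?\<theta> \<bullet> v" if "v \<in> K" for v
      using assigned_ineq_valid[OF nt assms(5)] K(3) that by blast
    show "quad_game \<in> K" using quad_game_exact K(2) by blast
    show "?\<theta> \<bullet> quad_game \<noteq> 0" using assigned_ineq_quad_game[OF nt assms(5)] by simp
    show "m \<in> K" "?\<theta> \<bullet> m = 0" using m K(2) by auto
    show "\<exists>\<epsilon>>0. m + \<epsilon> *\<^sub>R d \<in> K" if "d \<in> W" "?\<theta> \<bullet> d = 0" for d
      using m(3) that K(2) by (fastforce simp: W_def)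
  qed
  have "facet_defining ?\<theta> totally_balanced_cone"
    by (intro facet convex_totally_balanced_cone exact_subset_totally_balanced order_refl)
  moreover have "facet_defining ?\<theta> exact_cone"
    by (intro facet convex_exact_cone exact_subset_totally_balanced order_refl)
  ultimately show ?thesis
    using facet_defining_conjugate[OF assigned_ineq_sum[OF nt]] by blast
qed

end
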